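(* Let $P,Q\in\mathcal{L}(n)$ with $\mathrm{atoms}(P)=\mathrm{atoms}(Q)$ (the same labeled atoms $1,\dots,n$). If $P$ covers $Q$ in $\mathcal{L}(n)$, then for every $T\in\mathcal{S}_P\setminus\mathcal{S}_Q$, the element $p\in P$ with $\mathrm{supp}(p)=T$ is meet-irreducible in $P$.
   Context: $\mathcal{L}(n)$ denotes the set of finite atomic lattices (finite lattices with bottom $0$ and top in which every nonzero element is a join of atoms) with $n$ atoms labeled $1,\dots,n$. For $P\in\mathcal{L}(n)$ and $p\in P$, $\mathrm{supp}(p)$ is the set of (labels of) atoms below $p$, and $\mathcal{S}_P=\{\mathrm{supp}(p):p\in P\}$, a family of subsets of $\{1,\dots,n\}$ which, ordered by inclusion, is isomorphic to $P$. $\mathcal{L}(n)$ is partially ordered by: $Q\le P$ iff there exists a join-preserving map from $P$ to $Q$ which is a bijection on atoms (respecting the labels); $P$ covers $Q$ means $Q<P$ and there is no $R$ with $Q<R<P$. An element $x$ of a lattice is meet-irreducible if $x\neq a\wedge b$ for all $a>x$, $b>x$. *)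

theory Defs
  imports "HOL-Algebra.Lattice"
begin

record 'a labeled_lattice = "'a gorder" +
  label :: "nat \<Rightarrow> 'a"

definition atoms :: "('a, 'b) gorder_scheme \<Rightarrow> 'a set" where
  "atoms L = {a \<in> carrier L. \<bottom>\<^bsub>L\<^esub> \<sqsubset>\<^bsub>L\<^esub> a \<and> \<not> (\<exists>x\<in>carrier L. \<bottom>\<^bsub>L\<^esub> \<sqsubset>\<^bsub>L\<^esub> x \<and> x \<sqsubset>\<^bsub>L\<^esub> a)}"

definition atomic_lattice :: "('a, 'b) gorder_scheme \<Rightarrow> bool" where
  "atomic_lattice L \<longleftrightarrow> bounded_lattice L \<and>
     (\<forall>x\<in>carrier L. x \<noteq> \<bottom>\<^bsub>L\<^esub> \<longrightarrow> (\<exists>A\<subseteq>atoms L. x = \<Squnion>\<^bsub>L\<^esub>A))"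

definition meet_irreducible :: "('a, 'b) gorder_scheme \<Rightarrow> 'a \<Rightarrow> bool" where
  "meet_irreducible L x \<longleftrightarrow> x \<in> carrier L \<and>
     (\<forall>a\<in>carrier L. \<forall>b\<in>carrier L. x \<sqsubset>\<^bsub>L\<^esub> a \<longrightarrow> x \<sqsubset>\<^bsub>L\<^esub> b \<longrightarrow> x \<noteq> a \<sqinter>\<^bsub>L\<^esub> b)"

text \<open>Only the values of \<^const>\<open>label\<close> on \<open>{1..n}\<close> are meaningful.\<close>

definition labeled_atomic_lattices :: "nat \<Rightarrow> 'a labeled_lattice set" where
  "labeled_atomic_lattices n =
     {P. atomic_lattice P \<and> finite (carrier P) \<and> bij_betw (label P) {1..n} (atoms P)}"

definition supp :: "nat \<Rightarrow> 'a labeled_lattice \<Rightarrow> 'a \<Rightarrow> nat set" where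
  "supp n P p = {i \<in> {1..n}. label P i \<sqsubseteq>\<^bsub>P\<^esub> p}"

definition supports :: "nat \<Rightarrow> 'a labeled_lattice \<Rightarrow> nat set set" where
  "supports n P = supp n P ` carrier P"

definition lat_le :: "nat \<Rightarrow> 'a labeled_lattice \<Rightarrow> 'a labeled_lattice \<Rightarrow> bool" where
  "lat_le n Q P \<longleftrightarrow>
     (\<exists>f \<in> carrier P \<rightarrow> carrier Q. join_pres P Q f \<and> bij_betw f (atoms P) (atoms Q) \<and>
        (\<forall>i\<in>{1..n}. f (label P i) = label Q i))"

text \<open>Label-preserving isomorphism, which is what equality of two elements of the set of labeled
  atomic lattices means.\<close>

definition lat_iso :: "nat \<Rightarrow> 'a labeled_lattice \<Rightarrow> 'a labeled_lattice \<Rightarrow> bool" where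
  "lat_iso n Q P \<longleftrightarrow>
     (\<exists>f. bij_betw f (carrier Q) (carrier P) \<and> order_emb Q P f \<and>
        (\<forall>i\<in>{1..n}. f (label Q i) = label P i))"

definition lat_less :: "nat \<Rightarrow> 'a labeled_lattice \<Rightarrow> 'a labeled_lattice \<Rightarrow> bool" where
  "lat_less n Q P \<longleftrightarrow> lat_le n Q P \<and> \<not> lat_iso n Q P"

text \<open>Restricting \<open>R\<close> below to carriers in the type \<open>'a\<close> of \<open>P\<close> excludes nothing: elements of
  \<open>R\<close> are joins of atoms, so if \<open>R \<le> P\<close> then \<open>R\<close> has at most as many elements as \<open>P\<close> and is
  isomorphic to a lattice with carrier in \<open>'a\<close>.\<close>

definition lat_covers :: "nat \<Rightarrow> 'a labeled_lattice \<Rightarrow> 'a labeled_lattice \<Rightarrow> bool" where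
  "lat_covers n P Q \<longleftrightarrow> lat_less n Q P \<and>
     \<not> (\<exists>R \<in> labeled_atomic_lattices n. lat_less n Q R \<and> lat_less n R P)"

end

theory Submission
  imports Defs
begin

text \<open>In terms of supports, \<open>Q \<le> P\<close> is inclusion of families: every support of \<open>Q\<close> is a support
  of \<open>P\<close>. If \<open>t\<close> is maximal among the elements of \<open>P\<close> whose support is missing in \<open>Q\<close>, then \<open>t\<close> is
  meet-irreducible, since larger elements have supports in \<open>Q\<close> and the supports of \<open>Q\<close> are closed
  under intersection. Deleting \<open>t\<close> from \<open>P\<close> therefore leaves an atomic lattice \<open>R\<close> with
  \<open>Q \<le> R < P\<close>. As \<open>P\<close> covers \<open>Q\<close>, this forces \<open>R = Q\<close>, so \<open>t\<close> is the only element of \<open>P\<close> whose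
  support is missing in \<open>Q\<close>.\<close>

subsection \<open>Finite suprema and suborders\<close>

lemma sup_empty_eq_bottom: "\<Squnion>\<^bsub>L\<^esub>{} = \<bottom>\<^bsub>L\<^esub>"
  by (simp add: sup_def bottom_def)

lemma (in partial_order) eq_if_same_upper_bounds:
  assumes "x \<in> carrier L" "y \<in> carrier L"
    and "\<And>z. z \<in> carrier L \<Longrightarrow> x \<sqsubseteq> z \<longleftrightarrow> y \<sqsubseteq> z"
  shows "x = y"
  using assms(3)[of x] assms(3)[of y] assms(1,2) by (simp add: le_antisym)

context upper_semilattice
begin

lemma join_le_iff:
  assumes "x \<in> carrier L" "y \<in> carrier L" "z \<in> carrier L"
  shows "x \<squnion> y \<sqsubseteq> z \<longleftrightarrow> x \<sqsubseteq> z \<and> y \<sqsubseteq> z"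
  using assms by (meson join_closed join_le join_left join_right le_trans)

lemma finite_sup_le_iff:
  assumes "finite A" "A \<subseteq> carrier L" "A \<noteq> {}" "z \<in> carrier L"
  shows "\<Squnion>A \<sqsubseteq> z \<longleftrightarrow> (\<forall>a\<in>A. a \<sqsubseteq> z)"
proof -
  have lub: "least L (\<Squnion>A) (Upper L A)"
    using assms(1-3) by (rule finite_sup_least)
  show ?thesis
  proof (intro iffI ballI)
    fix a assume "\<Squnion>A \<sqsubseteq> z" "a \<in> A"
    then show "a \<sqsubseteq> z"
      using least_Upper_above[OF lub \<open>a \<in> A\<close> assms(2)] le_trans[of a "\<Squnion>A" z] assms by auto
  next
    assume "\<forall>a\<in>A. a \<sqsubseteq> z"
    then show "\<Squnion>A \<sqsubseteq> z"
      using assms(4) by (intro least_le[OF lub] Upper_memI) auto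
  qed
qed

lemma finite_sup_insert:
  assumes "finite A" "A \<subseteq> carrier L" "A \<noteq> {}" "x \<in> carrier L"
  shows "\<Squnion>(insert x A) = x \<squnion> \<Squnion>A"
proof (rule eq_if_same_upper_bounds)
  have closed: "\<Squnion>A \<in> carrier L" using assms(1-3) by simp
  then show "x \<squnion> \<Squnion>A \<in> carrier L" using assms(4) by simp
  show "\<Squnion>(insert x A) \<in> carrier L" using assms by simp
  fix z assume z: "z \<in> carrier L"
  have "\<Squnion>(insert x A) \<sqsubseteq> z \<longleftrightarrow> (\<forall>a\<in>insert x A. a \<sqsubseteq> z)"
    using assms z by (intro finite_sup_le_iff) auto
  also have "\<dots> \<longleftrightarrow> x \<squnion> \<Squnion>A \<sqsubseteq> z"
    using finite_sup_le_iff[OF assms(1-3) z] join_le_iff[OF assms(4) closed z] by simp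
  finally show "\<Squnion>(insert x A) \<sqsubseteq> z \<longleftrightarrow> x \<squnion> \<Squnion>A \<sqsubseteq> z" .
qed

end

lemma (in lower_semilattice) le_meet_iff:
  assumes "x \<in> carrier L" "y \<in> carrier L" "z \<in> carrier L"
  shows "z \<sqsubseteq> x \<sqinter> y \<longleftrightarrow> z \<sqsubseteq> x \<and> z \<sqsubseteq> y"
  using assms by (meson le_trans meet_closed meet_le meet_left meet_right)

lemma (in lower_semilattice) finite_with_top_imp_bounded_lattice:
  assumes finite: "finite (carrier L)"
    and top: "greatest L t (carrier L)"
  shows "bounded_lattice L"
proof
  fix x y assume xy: "x \<in> carrier L" "y \<in> carrier L"
  let ?U = "Upper L {x, y}"
  have "t \<in> ?U"
    using top xy by (auto simp: greatest_def Upper_def)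
  then have glb: "greatest L (\<Sqinter>?U) (Lower L ?U)"
    using finite_subset[OF Upper_closed finite] by (intro finite_inf_greatest) auto
  have "z \<sqsubseteq> \<Sqinter>?U" if "z \<in> {x, y}" for z
    using glb by (rule greatest_le) (use that xy in \<open>auto intro: Lower_memI\<close>)
  then have "least L (\<Sqinter>?U) ?U"
    using xy greatest_Lower_below[OF glb _ Upper_closed] greatest_closed[OF glb]
    by (intro least_UpperI) auto
  then show "\<exists>s. least L s ?U" ..
next
  have "greatest L (\<Sqinter>(carrier L)) (Lower L (carrier L))"
    using finite greatest_closed[OF top] by (intro finite_inf_greatest) auto
  then have "least L (\<Sqinter>(carrier L)) (carrier L)"
    by (auto simp: least_def greatest_def Lower_def)
  then show "\<exists>x. least L x (carrier L)" ..
  show "\<exists>x. greatest L x (carrier L)" using top ..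
qed

lemma (in lower_semilattice) meet_closed_suborder:
  assumes sub: "C \<subseteq> carrier L"
    and meet: "\<And>x y. x \<in> C \<Longrightarrow> y \<in> C \<Longrightarrow> x \<sqinter> y \<in> C"
  shows "lower_semilattice (L\<lparr>carrier := C\<rparr>)"
proof -
  let ?M = "L\<lparr>carrier := C\<rparr>"
  interpret sub: weak_partial_order ?M
    using weak_partial_order_axioms sub by (rule weak_partial_order_subset)
  show ?thesis
  proof
    fix x y assume "x \<in> carrier ?M" "y \<in> carrier ?M"
    then have "greatest ?M (x \<sqinter> y) (Lower ?M {x, y})"
      using meet sub
      by (auto simp: greatest_def Lower_def le_meet_iff subset_iff meet_left meet_right)
    then show "\<exists>s. greatest ?M s (Lower ?M {x, y})" ..
  qed (simp add: eq_is_equal)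
qed

context bounded_lattice
begin

lemma bounded_finite_sup_closed: "finite A \<Longrightarrow> A \<subseteq> carrier L \<Longrightarrow> \<Squnion>A \<in> carrier L"
  by (cases "A = {}") (simp_all add: sup_empty_eq_bottom)

lemma bounded_finite_sup_le_iff:
  "finite A \<Longrightarrow> A \<subseteq> carrier L \<Longrightarrow> z \<in> carrier L \<Longrightarrow> \<Squnion>A \<sqsubseteq> z \<longleftrightarrow> (\<forall>a\<in>A. a \<sqsubseteq> z)"
  by (cases "A = {}") (simp_all add: sup_empty_eq_bottom finite_sup_le_iff)

lemma bounded_lattice_meet_closed_suborder:
  assumes "finite (carrier L)" "C \<subseteq> carrier L" "\<top> \<in> C"
    and "\<And>x y. x \<in> C \<Longrightarrow> y \<in> C \<Longrightarrow> x \<sqinter> y \<in> C"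
  shows "bounded_lattice (L\<lparr>carrier := C\<rparr>)"
proof -
  let ?M = "L\<lparr>carrier := C\<rparr>"
  interpret sub: lower_semilattice ?M
    using assms(2,4) by (rule meet_closed_suborder)
  show ?thesis
  proof (rule sub.finite_with_top_imp_bounded_lattice)
    show "finite (carrier ?M)"
      using assms(1,2) finite_subset by auto
    show "greatest ?M \<top> (carrier ?M)"
      using assms(2,3) by (auto simp: greatest_def)
  qed
qed

end

lemma join_pres_finite_sup:
  assumes "f \<in> carrier X \<rightarrow> carrier Y" "join_pres X Y f"
    and "finite A" "A \<noteq> {}" "A \<subseteq> carrier X"
  shows "f (\<Squnion>\<^bsub>X\<^esub>A) = \<Squnion>\<^bsub>Y\<^esub>(f ` A)"
proof -
  interpret X: lattice X using assms(2) by (simp add: join_pres_def)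
  interpret Y: lattice Y using assms(2) by (simp add: join_pres_def)
  show ?thesis
    using assms(3-5)
  proof (induction rule: finite_ne_induct)
    case (singleton x)
    then have "\<Squnion>\<^bsub>X\<^esub>{x} = x" "\<Squnion>\<^bsub>Y\<^esub>{f x} = f x"
      using assms(1) X.weak_sup_of_singleton Y.weak_sup_of_singleton
      by (auto simp: X.eq_is_equal Y.eq_is_equal)
    then show ?case by simp
  next
    case (insert x A)
    then have "f ` A \<subseteq> carrier Y" "f x \<in> carrier Y" using assms(1) by auto
    then show ?case
      using insert assms(2) by (simp add: X.finite_sup_insert Y.finite_sup_insert join_pres_def)
  qed
qed

lemma lower_adjoint_join_pres:
  assumes "lattice X" "lattice Y"
    and f: "f \<in> carrier X \<rightarrow> carrier Y" and g: "g \<in> carrier Y \<rightarrow> carrier X"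
    and adjoint: "\<And>x y. x \<in> carrier X \<Longrightarrow> y \<in> carrier Y \<Longrightarrow> f x \<sqsubseteq>\<^bsub>Y\<^esub> y \<longleftrightarrow> x \<sqsubseteq>\<^bsub>X\<^esub> g y"
  shows "join_pres X Y f"
proof -
  interpret X: lattice X by fact
  interpret Y: lattice Y by fact
  have "f (x \<squnion>\<^bsub>X\<^esub> y) = f x \<squnion>\<^bsub>Y\<^esub> f y" if xy: "x \<in> carrier X" "y \<in> carrier X" for x y
  proof (rule Y.eq_if_same_upper_bounds)
    have closed: "f x \<in> carrier Y" "f y \<in> carrier Y" "f (x \<squnion>\<^bsub>X\<^esub> y) \<in> carrier Y"
      using f xy by auto
    then show "f (x \<squnion>\<^bsub>X\<^esub> y) \<in> carrier Y" "f x \<squnion>\<^bsub>Y\<^esub> f y \<in> carrier Y" by simp_all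
    fix z assume z: "z \<in> carrier Y"
    then have "g z \<in> carrier X" using g by blast
    then show "f (x \<squnion>\<^bsub>X\<^esub> y) \<sqsubseteq>\<^bsub>Y\<^esub> z \<longleftrightarrow> f x \<squnion>\<^bsub>Y\<^esub> f y \<sqsubseteq>\<^bsub>Y\<^esub> z"
      using xy z closed by (simp add: adjoint X.join_le_iff Y.join_le_iff)
  qed
  then show ?thesis
    using assms(1,2) by (simp add: join_pres_def)
qed

subsection \<open>Finite atomic lattices\<close>

lemma atoms_subset_carrier: "atoms L \<subseteq> carrier L"
  by (auto simp: atoms_def)

context bounded_lattice
begin

lemma bottom_notin_atoms: "\<bottom> \<notin> atoms L"
  by (simp add: atoms_def lless_eq)

lemma atom_le_atom_iff: "a \<in> atoms L \<Longrightarrow> b \<in> atoms L \<Longrightarrow> a \<sqsubseteq> b \<longleftrightarrow> a = b"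
  by (auto simp: atoms_def lless_eq)

lemma atom_not_le_bottom: "a \<in> atoms L \<Longrightarrow> \<not> a \<sqsubseteq> \<bottom>"
  using atoms_subset_carrier[of L] bottom_notin_atoms le_antisym[of a \<bottom>] by auto

lemma bottom_suborder:
  assumes "C \<subseteq> carrier L" "\<bottom> \<in> C"
  shows "\<bottom>\<^bsub>L\<lparr>carrier := C\<rparr>\<^esub> = \<bottom>"
  unfolding bottom_def[of "L\<lparr>carrier := C\<rparr>"]
proof (rule some_equality)
  show "least (L\<lparr>carrier := C\<rparr>) \<bottom> (carrier (L\<lparr>carrier := C\<rparr>))"
    using assms by (auto simp: least_def)
  fix x assume "least (L\<lparr>carrier := C\<rparr>) x (carrier (L\<lparr>carrier := C\<rparr>))"
  then have "x \<in> carrier L" "x \<sqsubseteq> \<bottom>" using assms by (auto simp: least_def)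
  then show "x = \<bottom>" by (intro le_antisym) simp_all
qed

lemma sup_atoms_below:
  assumes "finite (carrier L)" "x \<in> carrier L"
    and determined: "\<And>y. y \<in> carrier L \<Longrightarrow> (\<And>a. a \<in> atoms L \<Longrightarrow> a \<sqsubseteq> x \<Longrightarrow> a \<sqsubseteq> y) \<Longrightarrow> x \<sqsubseteq> y"
  shows "\<Squnion>{a \<in> atoms L. a \<sqsubseteq> x} = x"
proof -
  let ?A = "{a \<in> atoms L. a \<sqsubseteq> x}"
  have subset: "?A \<subseteq> carrier L" using atoms_subset_carrier[of L] by auto
  then have finite: "finite ?A" using assms(1) by (rule finite_subset)
  have "\<Squnion>?A \<sqsubseteq> z \<longleftrightarrow> x \<sqsubseteq> z" if z: "z \<in> carrier L" for z
  proof -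
    have "a \<sqsubseteq> z" if "a \<in> ?A" "x \<sqsubseteq> z" for a
      using that subset z assms(2) le_trans by blast
    then show ?thesis
      using determined[OF z] by (auto simp: bounded_finite_sup_le_iff[OF finite subset z])
  qed
  then show ?thesis
    using bounded_finite_sup_closed[OF finite subset] assms(2) by (intro eq_if_same_upper_bounds)
qed

end

locale finite_atomic_lattice = bounded_lattice L for L (structure) +
  assumes finite_carrier: "finite (carrier L)"
    and atomistic: "x \<in> carrier L \<Longrightarrow> x \<noteq> \<bottom> \<Longrightarrow> \<exists>A\<subseteq>atoms L. x = \<Squnion>A"
begin

lemma le_if_atoms_le:
  assumes "x \<in> carrier L" "y \<in> carrier L"
    and "\<And>a. a \<in> atoms L \<Longrightarrow> a \<sqsubseteq> x \<Longrightarrow> a \<sqsubseteq> y"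
  shows "x \<sqsubseteq> y"
proof (cases "x = \<bottom>")
  case True
  then show ?thesis using assms(2) by simp
next
  case False
  then obtain A where A: "A \<subseteq> atoms L" "x = \<Squnion>A" using atomistic assms(1) by blast
  then have subset: "A \<subseteq> carrier L" using atoms_subset_carrier[of L] by simp
  then have finite: "finite A" using finite_carrier by (rule finite_subset)
  have "\<forall>a\<in>A. a \<sqsubseteq> x"
    using bounded_finite_sup_le_iff[OF finite subset assms(1)] A(2) assms(1) by simp
  then show ?thesis
    using bounded_finite_sup_le_iff[OF finite subset assms(2)] A assms(3) by blast
qed

lemma atoms_suborder:
  assumes "C \<subseteq> carrier L" "\<bottom> \<in> C" "atoms L \<subseteq> C"
  shows "atoms (L\<lparr>carrier := C\<rparr>) = atoms L"
proof -
  let ?M = "L\<lparr>carrier := C\<rparr>"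
  have suborder_atoms: "atoms ?M = {a \<in> C. \<bottom> \<sqsubset> a \<and> \<not> (\<exists>x\<in>C. \<bottom> \<sqsubset> x \<and> x \<sqsubset> a)}"
    by (simp add: atoms_def bottom_suborder[OF assms(1,2)] lless_def)
  show ?thesis
  proof
    show "atoms L \<subseteq> atoms ?M"
      unfolding suborder_atoms using assms by (auto simp: atoms_def)
    show "atoms ?M \<subseteq> atoms L"
    proof
      fix a assume "a \<in> atoms ?M"
      then have a: "a \<in> carrier L" "\<bottom> \<sqsubset> a" and minimal: "\<And>x. x \<in> C \<Longrightarrow> \<bottom> \<sqsubset> x \<Longrightarrow> \<not> x \<sqsubset> a"
        unfolding suborder_atoms using assms(1) by auto
      then have "\<not> a \<sqsubseteq> \<bottom>" using le_antisym by (auto simp: lless_eq)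
      then obtain b where b: "b \<in> atoms L" "b \<sqsubseteq> a" using le_if_atoms_le[OF a(1)] by blast
      then have "b = a" using minimal[of b] assms(3) by (auto simp: atoms_def lless_eq)
      with b(1) show "a \<in> atoms L" by simp
    qed
  qed
qed

text \<open>The joins of the suborder may differ from those of \<^term>\<open>L\<close>.\<close>

lemma finite_atomic_lattice_suborder:
  assumes C: "C \<subseteq> carrier L" "\<bottom> \<in> C" "\<top> \<in> C" "atoms L \<subseteq> C"
    and meet: "\<And>x y. x \<in> C \<Longrightarrow> y \<in> C \<Longrightarrow> x \<sqinter> y \<in> C"
  shows "finite_atomic_lattice (L\<lparr>carrier := C\<rparr>)"
proof -
  let ?M = "L\<lparr>carrier := C\<rparr>"
  interpret sub: bounded_lattice ?M
    using finite_carrier C(1,3) meet by (rule bounded_lattice_meet_closed_suborder)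
  show ?thesis
  proof
    show finite: "finite (carrier ?M)"
      using finite_subset[OF C(1) finite_carrier] by simp
    fix x assume x: "x \<in> carrier ?M"
    let ?A = "{a \<in> atoms ?M. a \<sqsubseteq>\<^bsub>?M\<^esub> x}"
    have "\<Squnion>\<^bsub>?M\<^esub>?A = x"
      using finite x
    proof (rule sub.sup_atoms_below)
      fix y assume y: "y \<in> carrier ?M"
        and le: "\<And>a. a \<in> atoms ?M \<Longrightarrow> a \<sqsubseteq>\<^bsub>?M\<^esub> x \<Longrightarrow> a \<sqsubseteq>\<^bsub>?M\<^esub> y"
      have "x \<sqsubseteq> y"
        by (rule le_if_atoms_le) (use x y C(1) le in \<open>auto simp: atoms_suborder[OF C(1,2,4)]\<close>)
      then show "x \<sqsubseteq>\<^bsub>?M\<^esub> y" by simp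
    qed
    then show "\<exists>A\<subseteq>atoms ?M. x = \<Squnion>\<^bsub>?M\<^esub>A"
      by (intro exI[of _ ?A] conjI) (simp_all only: Collect_restrict)
  qed
qed

end

definition delete_element :: "('a, 'b) gorder_scheme \<Rightarrow> 'a \<Rightarrow> ('a, 'b) gorder_scheme" where
  "delete_element L t = L\<lparr>carrier := carrier L - {t}\<rparr>"

lemma (in lower_semilattice) meet_irreducibleD:
  assumes "meet_irreducible L t" "x \<in> carrier L" "y \<in> carrier L" "x \<sqinter> y = t"
  shows "x = t \<or> y = t"
  using assms meet_left[of x y] meet_right[of x y] unfolding meet_irreducible_def lless_eq by metis

lemma (in finite_atomic_lattice) finite_atomic_lattice_delete:
  assumes "meet_irreducible L t" "t \<noteq> \<bottom>" "t \<noteq> \<top>" "t \<notin> atoms L"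
  shows "finite_atomic_lattice (delete_element L t)"
  unfolding delete_element_def
proof (rule finite_atomic_lattice_suborder)
  show "atoms L \<subseteq> carrier L - {t}"
    using atoms_subset_carrier[of L] assms(4) by (simp add: subset_Diff_insert)
  fix x y assume "x \<in> carrier L - {t}" "y \<in> carrier L - {t}"
  then show "x \<sqinter> y \<in> carrier L - {t}"
    using meet_irreducibleD[OF assms(1), of x y] by auto
qed (use assms in simp_all)

subsection \<open>Supports\<close>

definition label_join :: "'a labeled_lattice \<Rightarrow> nat set \<Rightarrow> 'a" where
  "label_join P S = \<Squnion>\<^bsub>P\<^esub>(label P ` S)"

locale labeled_atomic_lattice = finite_atomic_lattice P
  for n :: nat and P :: "'a labeled_lattice" (structure) +
  assumes bij_label: "bij_betw (label P) {1..n} (atoms P)"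

lemma mem_labeled_atomic_lattices_iff:
  "P \<in> labeled_atomic_lattices n \<longleftrightarrow> labeled_atomic_lattice n P"
  by (auto simp: labeled_atomic_lattices_def atomic_lattice_def labeled_atomic_lattice_def
      labeled_atomic_lattice_axioms_def finite_atomic_lattice_def finite_atomic_lattice_axioms_def)

lemma supp_subset_labels: "supp n P x \<subseteq> {1..n}"
  by (auto simp: supp_def)

lemma supp_in_supports: "x \<in> carrier P \<Longrightarrow> supp n P x \<in> supports n P"
  by (simp add: supports_def)

lemma in_supportsE:
  assumes "S \<in> supports n P"
  obtains x where "x \<in> carrier P" "S = supp n P x"
  using assms by (auto simp: supports_def)

lemma in_supports_subset_labels: "S \<in> supports n P \<Longrightarrow> S \<subseteq> {1..n}"
  by (elim in_supportsE) (simp only: supp_subset_labels)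

context labeled_atomic_lattice
begin

lemma atoms_eq_labels: "atoms P = label P ` {1..n}"
  using bij_label by (simp add: bij_betw_def)

lemma label_atom: "i \<in> {1..n} \<Longrightarrow> label P i \<in> atoms P"
  by (simp add: atoms_eq_labels)

lemma label_closed: "i \<in> {1..n} \<Longrightarrow> label P i \<in> carrier P"
  using label_atom atoms_subset_carrier[of P] by auto

lemma label_le_label_iff:
  "i \<in> {1..n} \<Longrightarrow> j \<in> {1..n} \<Longrightarrow> label P i \<sqsubseteq> label P j \<longleftrightarrow> i = j"
  using atom_le_atom_iff[OF label_atom label_atom]
    inj_on_eq_iff[OF bij_betw_imp_inj_on[OF bij_label]] by simp

lemma supp_bottom: "supp n P \<bottom> = {}"
  using atom_not_le_bottom label_atom by (auto simp: supp_def)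

lemma supp_top: "supp n P \<top> = {1..n}"
  using label_closed by (auto simp: supp_def)

lemma supp_label: "i \<in> {1..n} \<Longrightarrow> supp n P (label P i) = {i}"
  using label_le_label_iff by (auto simp: supp_def)

lemma supp_meet:
  "x \<in> carrier P \<Longrightarrow> y \<in> carrier P \<Longrightarrow> supp n P (x \<sqinter> y) = supp n P x \<inter> supp n P y"
  using le_meet_iff label_closed by (auto simp: supp_def)

lemma finite_labels:
  assumes "S \<subseteq> {1..n}"
  shows "finite (label P ` S)" "label P ` S \<subseteq> carrier P"
  using assms label_closed finite_subset[OF assms] by auto

lemma label_join_closed: "S \<subseteq> {1..n} \<Longrightarrow> label_join P S \<in> carrier P"
  unfolding label_join_def by (intro bounded_finite_sup_closed finite_labels)

lemma label_join_le_iff: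
  "S \<subseteq> {1..n} \<Longrightarrow> x \<in> carrier P \<Longrightarrow> label_join P S \<sqsubseteq> x \<longleftrightarrow> S \<subseteq> supp n P x"
  unfolding label_join_def by (auto simp: bounded_finite_sup_le_iff finite_labels supp_def)

lemma label_join_supp:
  assumes "x \<in> carrier P"
  shows "label_join P (supp n P x) = x"
proof -
  have "label P ` supp n P x = {a \<in> atoms P. a \<sqsubseteq> x}"
    by (auto simp: atoms_eq_labels supp_def)
  then show ?thesis
    unfolding label_join_def
    using sup_atoms_below[OF finite_carrier assms] le_if_atoms_le[OF assms] by simp
qed

lemma supp_label_join: "S \<in> supports n P \<Longrightarrow> supp n P (label_join P S) = S"
  by (elim in_supportsE) (simp add: label_join_supp)

lemma supp_subset_iff:
  "x \<in> carrier P \<Longrightarrow> y \<in> carrier P \<Longrightarrow> supp n P x \<subseteq> supp n P y \<longleftrightarrow> x \<sqsubseteq> y"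
  using label_join_le_iff[OF supp_subset_labels] label_join_supp by metis

lemma inj_on_supp: "inj_on (supp n P) (carrier P)"
  by (rule inj_on_inverseI) (rule label_join_supp)

lemma empty_in_supports: "{} \<in> supports n P"
  using supp_in_supports[of \<bottom> P n] by (simp add: supp_bottom)

lemma labels_in_supports: "{1..n} \<in> supports n P"
  using supp_in_supports[of \<top> P n] by (simp add: supp_top)

lemma singleton_in_supports: "i \<in> {1..n} \<Longrightarrow> {i} \<in> supports n P"
  using supp_in_supports[of "label P i" P n] by (simp add: supp_label label_closed)

lemma Int_in_supports: "S \<in> supports n P \<Longrightarrow> T \<in> supports n P \<Longrightarrow> S \<inter> T \<in> supports n P"
  by (elim in_supportsE) (metis meet_closed supp_in_supports supp_meet)

lemma missing_support_meet_irreducible: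
  assumes Int_closed: "\<And>S T. S \<in> F \<Longrightarrow> T \<in> F \<Longrightarrow> S \<inter> T \<in> F"
    and missing: "\<not> supports n P \<subseteq> F"
  obtains t where "meet_irreducible P t" "supp n P t \<notin> F"
proof -
  have "finite (supports n P - F)" "supports n P - F \<noteq> {}"
    using finite_carrier missing by (auto simp: supports_def)
  from finite_has_maximal[OF this] obtain t where t: "t \<in> carrier P" "supp n P t \<notin> F"
    and maximal: "\<And>S. S \<in> supports n P - F \<Longrightarrow> supp n P t \<subseteq> S \<Longrightarrow> supp n P t = S"
    by (auto elim: in_supportsE)
  have above: "supp n P x \<in> F" if x: "x \<in> carrier P" "t \<sqsubset> x" for x
  proof -
    have "supp n P t \<subseteq> supp n P x" "supp n P t \<noteq> supp n P x"
      using x t(1) supp_subset_iff inj_on_eq_iff[OF inj_on_supp] by (simp_all add: lless_eq)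
    then show ?thesis using maximal supp_in_supports[OF x(1)] by blast
  qed
  have "meet_irreducible P t"
    unfolding meet_irreducible_def
  proof (intro conjI ballI impI notI)
    fix x y assume xy: "x \<in> carrier P" "y \<in> carrier P" "t \<sqsubset> x" "t \<sqsubset> y" "t = x \<sqinter> y"
    then have "supp n P t = supp n P x \<inter> supp n P y" using supp_meet by simp
    then show False using above xy Int_closed t(2) by simp
  qed (fact t(1))
  then show thesis using t(2) that by blast
qed

lemma supports_delete:
  assumes "t \<in> carrier P"
  shows "supports n (delete_element P t) = supports n P - {supp n P t}"
proof -
  have "supports n (delete_element P t) = supp n P ` (carrier P - {t})"
    by (simp add: delete_element_def supports_def supp_def)
  also have "\<dots> = supports n P - {supp n P t}"
    using inj_on_image_set_diff[OF inj_on_supp, of "carrier P" "{t}"] assms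
    by (simp add: supports_def)
  finally show ?thesis .
qed

lemma labeled_atomic_lattice_delete:
  assumes irreducible: "meet_irreducible P t"
    and "supp n P t \<noteq> {}" "supp n P t \<noteq> {1..n}" "\<And>i. i \<in> {1..n} \<Longrightarrow> supp n P t \<noteq> {i}"
  shows "labeled_atomic_lattice n (delete_element P t)"
proof -
  have proper: "t \<noteq> \<bottom>" "t \<noteq> \<top>" "t \<notin> atoms P"
    using assms(2-4) supp_bottom supp_top supp_label unfolding atoms_eq_labels by blast+
  interpret delete: finite_atomic_lattice "delete_element P t"
    using irreducible proper by (rule finite_atomic_lattice_delete)
  show ?thesis
  proof
    have "atoms (delete_element P t) = atoms P"
      unfolding delete_element_def
      using proper atoms_subset_carrier[of P] by (intro atoms_suborder) auto
    then show "bij_betw (label (delete_element P t)) {1..n} (atoms (delete_element P t))"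
      using bij_label by (simp add: delete_element_def)
  qed
qed

end

subsection \<open>The order on labeled atomic lattices\<close>

definition label_map ::
  "nat \<Rightarrow> 'a labeled_lattice \<Rightarrow> 'a labeled_lattice \<Rightarrow> 'a \<Rightarrow> 'a" where
  "label_map n P Q x = label_join Q (supp n P x)"

locale labeled_atomic_lattice_pair =
  P: labeled_atomic_lattice n P + Q: labeled_atomic_lattice n Q
  for n :: nat and P Q :: "'a labeled_lattice"
begin

lemma label_map_closed: "label_map n P Q x \<in> carrier Q"
  unfolding label_map_def by (intro Q.label_join_closed supp_subset_labels)

lemma label_map_le_iff:
  "q \<in> carrier Q \<Longrightarrow> label_map n P Q x \<sqsubseteq>\<^bsub>Q\<^esub> q \<longleftrightarrow> supp n P x \<subseteq> supp n Q q"
  unfolding label_map_def by (intro Q.label_join_le_iff supp_subset_labels)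

lemma label_map_label: "i \<in> {1..n} \<Longrightarrow> label_map n P Q (label P i) = label Q i"
  using Q.label_join_supp[OF Q.label_closed] by (simp add: label_map_def P.supp_label Q.supp_label)

lemma supp_label_map:
  "supp n P x \<in> supports n Q \<Longrightarrow> supp n Q (label_map n P Q x) = supp n P x"
  by (simp add: label_map_def Q.supp_label_join)

lemma label_map_inverse:
  "x \<in> carrier P \<Longrightarrow> supp n P x \<in> supports n Q \<Longrightarrow> label_map n Q P (label_map n P Q x) = x"
  by (simp add: label_map_def[of n Q P] supp_label_map P.label_join_supp)

lemma pair_commute: "labeled_atomic_lattice_pair n Q P" ..

lemma supports_subset_if_lat_le:
  assumes "lat_le n Q P"
  shows "supports n Q \<subseteq> supports n P"
proof
  obtain f where f: "f \<in> carrier P \<rightarrow> carrier Q" "join_pres P Q f"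
    and f_label: "\<And>i. i \<in> {1..n} \<Longrightarrow> f (label P i) = label Q i"
    using assms by (auto simp: lat_le_def)
  fix S assume S: "S \<in> supports n Q"
  show "S \<in> supports n P"
  proof (cases "S = {}") \<comment> \<open>\<open>f\<close> need not preserve the bottom element\<close>
    case True
    then show ?thesis using P.empty_in_supports by simp
  next
    case False
    have S_labels: "S \<subseteq> {1..n}" using S by (rule in_supports_subset_labels)
    define p where "p = label_join P S"
    have p: "p \<in> carrier P" unfolding p_def using S_labels by (rule P.label_join_closed)
    have "f p = \<Squnion>\<^bsub>Q\<^esub>(f ` label P ` S)"
      unfolding p_def label_join_def
      using f P.finite_labels[OF S_labels] False by (intro join_pres_finite_sup) auto
    also have "f ` label P ` S = label Q ` S"
      unfolding image_image using S_labels f_label by (intro image_cong) auto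
    finally have "f p = label_join Q S" unfolding label_join_def .
    then have supp_fp: "supp n Q (f p) = S" using S by (simp add: Q.supp_label_join)
    have "label Q i \<sqsubseteq>\<^bsub>Q\<^esub> f p" if "i \<in> {1..n}" "label P i \<sqsubseteq>\<^bsub>P\<^esub> p" for i
      using use_iso2[OF join_pres_isotone[OF f] P.label_closed p] that f_label by metis
    then have "supp n P p \<subseteq> supp n Q (f p)" by (auto simp: supp_def)
    moreover have "S \<subseteq> supp n P p"
      using P.label_join_le_iff[OF S_labels p] p by (simp add: p_def)
    ultimately have "supp n P p = S" using supp_fp by blast
    then show ?thesis using supp_in_supports[OF p, of n] by simp
  qed
qed

lemma lat_le_if_supports_subset:
  assumes "supports n Q \<subseteq> supports n P"
  shows "lat_le n Q P"
  unfolding lat_le_def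
proof (intro bexI conjI ballI)
  interpret QP: labeled_atomic_lattice_pair n Q P by (rule pair_commute)
  show closed: "label_map n P Q \<in> carrier P \<rightarrow> carrier Q"
    by (intro Pi_I label_map_closed)
  show "join_pres P Q (label_map n P Q)"
  proof (rule lower_adjoint_join_pres[OF P.lattice_axioms Q.lattice_axioms closed])
    show "label_map n Q P \<in> carrier Q \<rightarrow> carrier P"
      by (intro Pi_I QP.label_map_closed)
    fix p q assume p: "p \<in> carrier P" and q: "q \<in> carrier Q"
    have "supp n P (label_map n Q P q) = supp n Q q"
      using subsetD[OF assms supp_in_supports[OF q]] by (rule QP.supp_label_map)
    then show "label_map n P Q p \<sqsubseteq>\<^bsub>Q\<^esub> q \<longleftrightarrow> p \<sqsubseteq>\<^bsub>P\<^esub> label_map n Q P q"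
      by (simp add: label_map_le_iff[OF q] flip: P.supp_subset_iff[OF p QP.label_map_closed])
  qed
  have "bij_betw (label_map n P Q \<circ> label P) {1..n} (atoms Q)"
    using bij_betw_cong[of "{1..n}" "label_map n P Q \<circ> label P" "label Q"] Q.bij_label
    by (simp add: label_map_label)
  then show "bij_betw (label_map n P Q) (atoms P) (atoms Q)"
    using P.bij_label bij_betw_comp_iff by blast
qed (rule label_map_label)

lemma lat_le_iff_supports_subset: "lat_le n Q P \<longleftrightarrow> supports n Q \<subseteq> supports n P"
  using supports_subset_if_lat_le lat_le_if_supports_subset by blast

lemma supports_eq_if_lat_iso:
  assumes "lat_iso n Q P"
  shows "supports n Q = supports n P"
proof -
  obtain f where f: "bij_betw f (carrier Q) (carrier P)" "order_emb Q P f"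
    and f_label: "\<And>i. i \<in> {1..n} \<Longrightarrow> f (label Q i) = label P i"
    using assms by (auto simp: lat_iso_def)
  have "supp n P (f q) = supp n Q q" if "q \<in> carrier Q" for q
    using f(2) that f_label Q.label_closed unfolding order_emb_def supp_def
    by (metis (no_types, lifting))
  then have "supp n Q ` carrier Q = supp n P ` f ` carrier Q"
    by (simp add: image_image)
  then show ?thesis using f(1) by (simp add: supports_def bij_betw_def)
qed

lemma lat_iso_if_supports_eq:
  assumes "supports n Q = supports n P"
  shows "lat_iso n Q P"
  unfolding lat_iso_def
proof (intro exI conjI ballI)
  interpret QP: labeled_atomic_lattice_pair n Q P by (rule pair_commute)
  have supp_in: "supp n Q q \<in> supports n P" if "q \<in> carrier Q" for q
    using supp_in_supports[OF that, of n] assms by simp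
  show "bij_betw (label_map n Q P) (carrier Q) (carrier P)"
  proof (rule bij_betw_byWitness)
    show "\<forall>q\<in>carrier Q. label_map n P Q (label_map n Q P q) = q"
      by (simp add: supp_in QP.label_map_inverse)
    show "\<forall>p\<in>carrier P. label_map n Q P (label_map n P Q p) = p"
      by (simp add: assms supp_in_supports label_map_inverse)
  qed (use label_map_closed QP.label_map_closed in auto)
  show "order_emb Q P (label_map n Q P)"
    unfolding order_emb_def
    using P.weak_partial_order_axioms Q.weak_partial_order_axioms supp_in
    by (simp add: QP.label_map_le_iff QP.label_map_closed QP.supp_label_map Q.supp_subset_iff)
qed (rule labeled_atomic_lattice_pair.label_map_label[OF pair_commute])

lemma lat_iso_iff_supports_eq: "lat_iso n Q P \<longleftrightarrow> supports n Q = supports n P"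
  using supports_eq_if_lat_iso lat_iso_if_supports_eq by blast

lemma lat_less_iff_supports_psubset: "lat_less n Q P \<longleftrightarrow> supports n Q \<subset> supports n P"
  unfolding lat_less_def psubset_eq
  by (simp add: lat_le_iff_supports_subset lat_iso_iff_supports_eq)

end

lemma lat_covers_missing_support:
  assumes P: "labeled_atomic_lattice n P" and Q: "labeled_atomic_lattice n Q"
    and covers: "lat_covers n P Q"
  obtains t where "meet_irreducible P t" "supports n P - supports n Q = {supp n P t}"
proof -
  interpret P: labeled_atomic_lattice n P by fact
  interpret Q: labeled_atomic_lattice n Q by fact
  note less_iff = labeled_atomic_lattice_pair.lat_less_iff_supports_psubset
      [OF labeled_atomic_lattice_pair.intro]
  have QP_subset: "supports n Q \<subset> supports n P"
    using covers less_iff[OF P Q] by (simp add: lat_covers_def)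
  then obtain t where t: "meet_irreducible P t" "supp n P t \<notin> supports n Q"
    using P.missing_support_meet_irreducible[OF Q.Int_in_supports] by blast
  then have t_closed: "t \<in> carrier P" by (simp add: meet_irreducible_def)
  define R where "R = delete_element P t"
  have R: "labeled_atomic_lattice n R"
    unfolding R_def using t Q.empty_in_supports Q.labels_in_supports Q.singleton_in_supports
    by (intro P.labeled_atomic_lattice_delete) auto
  have supports_R: "supports n R = supports n P - {supp n P t}"
    unfolding R_def using t_closed by (rule P.supports_delete)
  have "lat_less n R P"
    using less_iff[OF P R] supports_R supp_in_supports[OF t_closed] by blast
  then have "\<not> lat_less n Q R"
    using covers R by (auto simp: lat_covers_def mem_labeled_atomic_lattices_iff)
  then have "supports n Q = supports n P - {supp n P t}"
    using less_iff[OF R Q] supports_R QP_subset t(2) by blast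
  then have "supports n P - supports n Q = {supp n P t}"
    using supp_in_supports[OF t_closed] by blast
  with t(1) show thesis by (rule that)
qed

theorem theorem4p3:
  fixes n :: nat and P Q :: "'a labeled_lattice"
  assumes "P \<in> labeled_atomic_lattices n"
    and "Q \<in> labeled_atomic_lattices n"
    and "lat_covers n P Q"
  shows "\<forall>T \<in> supports n P - supports n Q.
           \<forall>p \<in> carrier P. supp n P p = T \<longrightarrow> meet_irreducible P p"
proof (intro ballI impI)
  interpret P: labeled_atomic_lattice n P
    using assms(1) by (simp add: mem_labeled_atomic_lattices_iff)
  obtain t where t: "meet_irreducible P t" "supports n P - supports n Q = {supp n P t}"
    using assms unfolding mem_labeled_atomic_lattices_iff by (rule lat_covers_missing_support)
  fix T p assume "T \<in> supports n P - supports n Q" "p \<in> carrier P" "supp n P p = T"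
  moreover have "t \<in> carrier P" using t(1) by (simp add: meet_irreducible_def)
  ultimately have "p = t" using t(2) inj_onD[OF P.inj_on_supp] by blast
  with t(1) show "meet_irreducible P p" by simp
qed

end
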